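(* The generating function for the distribution of the first letter statistic on $\mathcal{S}_n(1243,1324)$ for $n\ge1$ is given by $$\sum_{n\ge1}\ \sum_{\pi\in\mathcal{S}_n(1243,1324)}v^{\pi_1}x^n=\frac{vx(2-3v-3x+3vx)+vx(v+x-vx)\left(vx+\sqrt{1-6vx+v^2x^2}\right)}{2(1-v-2x+vx)}.$$
   Context: $\mathcal{S}_n(\sigma,\tau)$ is the set of permutations $\pi=\pi_1\cdots\pi_n$ of $[n]$ avoiding both patterns $\sigma$ and $\tau$ (classical pattern avoidance). The first letter statistic is $\pi_1$. The identity is between formal power series in $x$ with coefficients rational functions of $v$; the square root is the power series with constant term $1$. *)

theory Defs
  imports
    "HOL-Computational_Algebra.Computational_Algebra"
    "HOL-Combinatorics.Multiset_Permutations"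
    "HOL-Library.Sublist"
begin

(* Permutations of [n] in one-line notation are lists; subseq is the (not necessarily
   contiguous) subsequence order on lists. *)

definition order_isomorphic :: "nat list \<Rightarrow> nat list \<Rightarrow> bool" where
  "order_isomorphic xs ys \<longleftrightarrow> length xs = length ys \<and>
     (\<forall>i < length xs. \<forall>j < length xs. xs ! i < xs ! j \<longleftrightarrow> ys ! i < ys ! j)"

definition avoids :: "nat list \<Rightarrow> nat list \<Rightarrow> bool" where
  "avoids \<pi> \<sigma> \<longleftrightarrow> \<not> (\<exists>xs. subseq xs \<pi> \<and> order_isomorphic xs \<sigma>)"

definition avoiding_perms :: "nat \<Rightarrow> nat list \<Rightarrow> nat list \<Rightarrow> nat list set" where
  "avoiding_perms n \<sigma> \<tau> = {\<pi> \<in> permutations_of_set {1..n}. avoids \<pi> \<sigma> \<and> avoids \<pi> \<tau>}"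

type_synonym ratfun = "rat poly fract"

definition ratfun_var :: ratfun where
  "ratfun_var = Fract [:0, 1:] 1"

(* Only meaningful for series with constant term 1; the function argument of fps_radical
   chooses the root of the constant term. *)
definition fps_sqrt1 :: "'a :: field_char_0 fps \<Rightarrow> 'a fps" where
  "fps_sqrt1 a = fps_radical (\<lambda>_ _. 1) 2 a"

lemma fps_sqrt1_unique:
  fixes a b :: "'a :: field_char_0 fps"
  assumes "fps_nth a 0 = 1"
  shows "b = fps_sqrt1 a \<longleftrightarrow> b ^ 2 = a \<and> fps_nth b 0 = 1"
proof
  assume b: "b = fps_sqrt1 a"
  have "fps_radical (\<lambda>_ _. 1) (Suc 1) a ^ Suc 1 = a"
    using power_radical[of a "\<lambda>_ _. 1" 1] assms by simp
  then show "b ^ 2 = a \<and> fps_nth b 0 = 1"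
    using b by (simp add: fps_sqrt1_def numeral_2_eq_2)
next
  assume "b ^ 2 = a \<and> fps_nth b 0 = 1"
  then show "b = fps_sqrt1 a"
    using radical_unique[of "\<lambda>_ _. 1" 1 a b] assms
    by (simp add: fps_sqrt1_def numeral_2_eq_2)
qed

(* Hence the division in the generating function below is multiplication by an inverse. *)
lemma denominator_unit:
  "fps_nth (2 * (1 - fps_const ratfun_var - 2 * fps_X + fps_const ratfun_var * fps_X)) 0 \<noteq> 0"
proof -
  have "ratfun_var \<noteq> 1"
    by (simp add: ratfun_var_def One_fract_def eq_fract one_pCons)
  then show ?thesis
    by simp
qed

definition first_letter_gf :: "nat list \<Rightarrow> nat list \<Rightarrow> ratfun fps" where
  "first_letter_gf \<sigma> \<tau> =
     Abs_fps (\<lambda>n. if n \<ge> 1 then \<Sum>\<pi>\<in>avoiding_perms n \<sigma> \<tau>. ratfun_var ^ hd \<pi> else 0)"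

end

theory Submission
  imports Defs
begin

text \<open>
  The permutations are built from right to left, by inserting a new first letter \<open>k\<close> into a
  permutation \<open>\<sigma>\<close> of length \<open>n\<close>. Both patterns start with their smallest letter, and
  without it they become 132 and 213. So the insertion is legal exactly if the letters of
  \<open>\<sigma>\<close> that end up above \<open>k\<close> avoid 132 and 213 (\<open>avoids_both_Cons\<close>). Label \<open>\<sigma>\<close> with the
  largest \<open>l\<close> such that its \<open>l\<close> largest letters avoid 132 and 213; then the legal first letters
  are those with \<open>m \<le> l\<close> letters above them, that is \<open>n + 1 - m\<close> for \<open>m = 0, \<dots>, l\<close>. Hence the
  distribution of the first letter in length \<open>n + 1\<close> is known once the distribution of the
  labels in length \<open>n\<close> is.

  The label of the new permutation is a function of \<open>m\<close>, \<open>l\<close> and the number \<open>i\<close> of largest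
  letters that form an increasing sequence (\<open>layered_size_Cons\<close>). As \<open>m\<close> runs through
  \<open>0, \<dots>, l\<close>, the new labels are \<open>l + 1\<close> twice and each of \<open>2, \<dots>, l\<close> once, whatever \<open>i\<close> is
  (\<open>card_child_label\<close>). This is the succession rule of the large Schroeder numbers, and it
  involves a single label.

  Write \<open>A(x, s)\<close> for the sum of \<open>x\<^sup>n s\<^sup>l\<close> over all these permutations with \<open>n \<ge> 1\<close>. The
  rule gives a linear functional equation for \<open>A\<close> whose kernel is
  \<open>- (1 - (1 + x) s + 2 x s\<^sup>2) = - (1 - r s) (1 - R s)\<close>, where \<open>r\<close> and \<open>R\<close> are the roots of
  \<open>z\<^sup>2 - (1 + x) z + 2 x\<close> and \<open>R\<close> is the one without constant term. The factor with \<open>r\<close>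
  cancels, which leaves \<open>A(x, s) = x s / (1 - R s)\<close>: the number of permutations of length
  \<open>n + 1\<close> with label \<open>j + 1\<close> is the coefficient of \<open>x\<^sup>n\<close> in \<open>R\<^sup>j\<close>. Once guessed, this formula
  follows by induction on the length, because \<open>R = x (2 + R / (1 - R))\<close> is exactly the
  succession rule (\<open>label_count_eq_power\<close>).

  Marking the first letter by \<open>v\<close> replaces \<open>x\<close> by \<open>v x\<close> and sums \<open>v\<^sup>n\<^sup>+\<^sup>1\<^sup>-\<^sup>m\<close> over \<open>m \<le> l\<close>,
  which yields \<open>v x + (v x)\<^sup>2 (1 + 1 / (v - R)) / (1 - R)\<close>. Putting
  \<open>R = (1 + v x - sqrt (1 - 6 v x + v\<^sup>2 x\<^sup>2)) / 2\<close> and clearing denominators turns this into the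
  closed form.
\<close>

section \<open>Letters above a threshold\<close>

text \<open>
  The letters of \<open>xs\<close> from \<open>t\<close> upwards avoid 132 and 213. In each pattern only the smallest
  letter has to be compared with \<open>t\<close>. The permutations avoiding both patterns are a sequence of
  increasing runs of consecutive values, each run below the previous ones.
\<close>

definition layered_from :: "nat \<Rightarrow> nat list \<Rightarrow> bool" where
  "layered_from t xs \<longleftrightarrow>
     (\<forall>p q r. subseq [p, q, r] xs \<longrightarrow>
        \<not> (t \<le> p \<and> p < r \<and> r < q) \<and> \<not> (t \<le> q \<and> q < p \<and> p < r))"

definition increasing_from :: "nat \<Rightarrow> nat list \<Rightarrow> bool" where
  "increasing_from t xs \<longleftrightarrow> (\<forall>p q. subseq [p, q] xs \<longrightarrow> t \<le> p \<longrightarrow> t \<le> q \<longrightarrow> p < q)"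

text \<open>
  By monotonicity in the threshold, these are the numbers \<open>l\<close> and \<open>i\<close> of largest letters that
  avoid 132 and 213, or increase. Counting thresholds taken from the list itself makes them
  invariant under order-preserving relabelling, and keeps them meaningful for lists whose
  letters are not an initial segment.
\<close>
definition layered_size :: "nat list \<Rightarrow> nat" where
  "layered_size xs = card {a \<in> set xs. layered_from a xs}"

definition increasing_size :: "nat list \<Rightarrow> nat" where
  "increasing_size xs = card {a \<in> set xs. increasing_from a xs}"

definition avoids_both :: "nat list \<Rightarrow> bool" where
  "avoids_both xs \<longleftrightarrow>
     (\<forall>a b c d. subseq [a, b, c, d] xs \<longrightarrow>
        \<not> (a < b \<and> b < d \<and> d < c) \<and> \<not> (a < c \<and> c < b \<and> b < d))"

text \<open>Their numbers are the large Schroeder numbers, whence the name.\<close>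
definition schroeder_perms :: "nat \<Rightarrow> nat list set" where
  "schroeder_perms n = {\<pi> \<in> permutations_of_set {1..n}. avoids_both \<pi>}"

text \<open>
  For short patterns, splitting according to whether the first letter of the pattern is matched
  by the head of the list works better than a case distinction on equality of the two heads.
\<close>
lemma subseq_Cons_Cons_iff:
  "subseq (a # as) (x # xs) \<longleftrightarrow> subseq (a # as) xs \<or> a = x \<and> subseq as xs"
  by (metis subseq_Cons2_iff subseq_Cons' list_emb_Cons)

lemmas subseq_Cons_simps = subseq_Cons_Cons_iff subseq_singleton_left

declare subseq_Cons2_iff [simp del]

lemma subseq_set: "subseq ys xs \<Longrightarrow> set ys \<subseteq> set xs"
  by (induction rule: list_emb.induct) auto

lemma subseq_pair_total:
  assumes "p \<in> set xs" "q \<in> set xs" "p \<noteq> q"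
  shows "subseq [p, q] xs \<or> subseq [q, p] xs"
  using assms by (induction xs) (auto simp: subseq_Cons_simps)

text \<open>
  In a list without repetitions, \<open>subseq [p, q]\<close> says that \<open>p\<close> stands to the left of \<open>q\<close>, and
  longer subsequences are determined by these pairs.
\<close>
lemma subseq_pair_join:
  assumes "distinct xs" "subseq [p, q] xs" "subseq [q, r] xs"
  shows "subseq [p, q, r] xs"
  using assms
proof (induction xs)
  case (Cons x xs)
  then show ?case
    using subseq_set[of "[p, q]" xs] subseq_set[of "[q, r]" xs]
    by (auto simp: subseq_Cons_simps)
qed simp

lemma subseq_pair_trans:
  assumes "distinct xs" "subseq [p, q] xs" "subseq [q, r] xs"
  shows "subseq [p, r] xs"
proof -
  have "subseq [p, r] [p, q, r]" by (simp add: subseq_Cons_Cons_iff)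
  then show ?thesis
    using subseq_pair_join[OF assms] subseq_order.order_trans by blast
qed

lemma subseq_pair_neq:
  assumes "distinct xs" "subseq [p, q] xs"
  shows "p \<noteq> q"
  using assms by (induction xs) (auto simp: subseq_Cons_simps)

lemma subseq_map_iff:
  assumes "inj f"
  shows "subseq ys (map f xs) \<longleftrightarrow> (\<exists>zs. ys = map f zs \<and> subseq zs xs)"
proof
  assume "subseq ys (map f xs)"
  then show "\<exists>zs. ys = map f zs \<and> subseq zs xs"
  proof (induction xs arbitrary: ys)
    case (Cons x xs)
    show ?case
    proof (cases ys)
      case (Cons y ys')
      then consider "subseq ys (map f xs)" | "y = f x" "subseq ys' (map f xs)"
        using Cons.prems by (auto simp: subseq_Cons_Cons_iff)
      then show ?thesis
      proof cases
        case 1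
        then show ?thesis using Cons.IH by blast
      next
        case 2
        then obtain zs where "ys' = map f zs" "subseq zs xs" using Cons.IH by blast
        then have "ys = map f (x # zs) \<and> subseq (x # zs) (x # xs)"
          using 2 Cons by (simp add: subseq_Cons_Cons_iff)
        then show ?thesis by blast
      qed
    qed simp
  qed (auto elim: list_emb.cases)
next
  assume "\<exists>zs. ys = map f zs \<and> subseq zs xs"
  then show "subseq ys (map f xs)" using subseq_map by blast
qed

lemma avoids_both_iff:
  "avoids xs [1,2,4,3] \<and> avoids xs [1,3,2,4] \<longleftrightarrow> avoids_both xs"
proof -
  have len: "length ys = 4 \<longleftrightarrow> (\<exists>a b c d. ys = [a,b,c,d])" for ys :: "nat list"
    by (auto simp: numeral_eq_Suc length_Suc_conv)
  have "order_isomorphic ys [1,2,4,3] \<longleftrightarrow>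
      (\<exists>a b c d. ys = [a,b,c,d] \<and> a < b \<and> b < d \<and> d < c)" for ys
  proof (cases "length ys = 4")
    case True
    then obtain a b c d where "ys = [a,b,c,d]" using len by blast
    then show ?thesis by (auto simp: order_isomorphic_def All_less_Suc)
  qed (auto simp: order_isomorphic_def)
  moreover have "order_isomorphic ys [1,3,2,4] \<longleftrightarrow>
      (\<exists>a b c d. ys = [a,b,c,d] \<and> a < c \<and> c < b \<and> b < d)" for ys
  proof (cases "length ys = 4")
    case True
    then obtain a b c d where "ys = [a,b,c,d]" using len by blast
    then show ?thesis by (auto simp: order_isomorphic_def All_less_Suc)
  qed (auto simp: order_isomorphic_def)
  ultimately show ?thesis
    unfolding avoids_def avoids_both_def by metis
qed

lemma increasing_fromD:
  "increasing_from t xs \<Longrightarrow> subseq [p, q] xs \<Longrightarrow> t \<le> p \<Longrightarrow> t \<le> q \<Longrightarrow> p < q"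
  unfolding increasing_from_def by blast

lemma layered_from_no_132:
  "layered_from t xs \<Longrightarrow> subseq [p, q, r] xs \<Longrightarrow> t \<le> p \<Longrightarrow> p < r \<Longrightarrow> r < q \<Longrightarrow> False"
  unfolding layered_from_def by blast

lemma layered_from_no_213:
  "layered_from t xs \<Longrightarrow> subseq [p, q, r] xs \<Longrightarrow> t \<le> q \<Longrightarrow> q < p \<Longrightarrow> p < r \<Longrightarrow> False"
  unfolding layered_from_def by blast

text \<open>
  An occurrence of 1243 or 1324 that uses the new first letter uses it as its smallest letter,
  and what remains is an occurrence of 132 or 213 above it.
\<close>
lemma avoids_both_Cons:
  assumes "k \<notin> set xs"
  shows "avoids_both (k # xs) \<longleftrightarrow> avoids_both xs \<and> layered_from k xs"
proof -
  have "k \<le> b \<longleftrightarrow> k < b" if "b \<in> set xs" for b using that assms by (metis order.order_iff_strict)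
  then have "k \<le> b \<longleftrightarrow> k < b" "k \<le> c \<longleftrightarrow> k < c" if "subseq [b, c, d] xs" for b c d
    using subseq_set[OF that] by auto
  then have "layered_from k xs \<longleftrightarrow> (\<forall>b c d. subseq [b, c, d] xs \<longrightarrow>
      \<not> (k < b \<and> b < d \<and> d < c) \<and> \<not> (k < c \<and> c < b \<and> b < d))"
    unfolding layered_from_def by (simp cong: imp_cong)
  then show ?thesis
    unfolding avoids_both_def subseq_Cons_Cons_iff[of _ _ k xs] by blast
qed

lemma layered_from_Cons:
  "layered_from t (k # xs) \<longleftrightarrow> layered_from t xs \<and>
     (\<forall>q r. subseq [q, r] xs \<longrightarrow>
        \<not> (t \<le> k \<and> k < r \<and> r < q) \<and> \<not> (t \<le> q \<and> q < k \<and> k < r))"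
  unfolding layered_from_def subseq_Cons_Cons_iff[of _ _ k xs] by blast

lemma layered_from_mono: "layered_from a xs \<Longrightarrow> a \<le> b \<Longrightarrow> layered_from b xs"
  unfolding layered_from_def by (meson le_trans)

lemma increasing_from_mono: "increasing_from a xs \<Longrightarrow> a \<le> b \<Longrightarrow> increasing_from b xs"
  unfolding increasing_from_def by (meson le_trans)

lemma increasing_imp_layered:
  assumes "increasing_from t xs"
  shows "layered_from t xs"
  unfolding layered_from_def
proof (intro allI impI)
  fix p q r assume s: "subseq [p, q, r] xs"
  have "subseq [p, q] [p, q, r]" "subseq [q, r] [p, q, r]"
    by (simp_all add: subseq_Cons_simps)
  then have "subseq [p, q] xs" "subseq [q, r] xs"
    using s subseq_order.order_trans by blast+
  then have "t \<le> p \<Longrightarrow> t \<le> q \<Longrightarrow> p < q" "t \<le> q \<Longrightarrow> t \<le> r \<Longrightarrow> q < r"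
    using assms unfolding increasing_from_def by blast+
  then show "\<not> (t \<le> p \<and> p < r \<and> r < q) \<and> \<not> (t \<le> q \<and> q < p \<and> p < r)" by linarith
qed

text \<open>
  A property of thresholds that is preserved upwards and is decided by the elements of \<open>A\<close>
  holds precisely for a certain number of top elements, so it can be tested by counting.
  This turns legality of an insertion into an inequality between \<open>m\<close> and the label.
\<close>
lemma upward_predicate_iff_card_le:
  fixes A :: "nat set"
  assumes "finite A"
    and mono: "\<And>a b. Q a \<Longrightarrow> a \<le> b \<Longrightarrow> Q b"
    and local: "(\<forall>a\<in>A. t \<le> a \<longrightarrow> Q a) \<Longrightarrow> Q t"
  shows "Q t \<longleftrightarrow> card {a \<in> A. t \<le> a} \<le> card {a \<in> A. Q a}"
proof
  assume "Q t"
  then show "card {a \<in> A. t \<le> a} \<le> card {a \<in> A. Q a}"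
    using assms(1) mono by (intro card_mono) auto
next
  assume le: "card {a \<in> A. t \<le> a} \<le> card {a \<in> A. Q a}"
  show "Q t"
  proof (rule ccontr)
    assume "\<not> Q t"
    then obtain a where a: "a \<in> A" "t \<le> a" "\<not> Q a" using local by blast
    have "b > a" if "Q b" for b using mono[OF that, of a] a(3) by (meson not_le)
    then have "t \<le> b" if "Q b" for b using that a(2) by (meson le_trans less_imp_le_nat)
    then have "{a \<in> A. Q a} \<subseteq> {a \<in> A. t \<le> a} - {a}" using a(3) by blast
    then have "{a \<in> A. Q a} \<subset> {a \<in> A. t \<le> a}" using a(1,2) by blast
    then have "card {a \<in> A. Q a} < card {a \<in> A. t \<le> a}"
      using assms(1) by (intro psubset_card_mono) simp_all
    then show False using le by simp
  qed
qed

lemma layered_from_iff_card_le: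
  "layered_from t xs \<longleftrightarrow> card {a \<in> set xs. t \<le> a} \<le> layered_size xs"
  unfolding layered_size_def
proof (rule upward_predicate_iff_card_le)
  assume *: "\<forall>a\<in>set xs. t \<le> a \<longrightarrow> layered_from a xs"
  show "layered_from t xs"
    unfolding layered_from_def
  proof (intro allI impI)
    fix p q r assume s: "subseq [p, q, r] xs"
    then have "p \<in> set xs" "q \<in> set xs" using subseq_set by fastforce+
    then have "t \<le> p \<Longrightarrow> layered_from p xs" "t \<le> q \<Longrightarrow> layered_from q xs" using * by blast+
    then show "\<not> (t \<le> p \<and> p < r \<and> r < q) \<and> \<not> (t \<le> q \<and> q < p \<and> p < r)"
      using layered_from_no_132[OF _ s] layered_from_no_213[OF _ s] by blast
  qed
qed (auto intro: layered_from_mono)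

lemma increasing_from_iff_card_le:
  "increasing_from t xs \<longleftrightarrow> card {a \<in> set xs. t \<le> a} \<le> increasing_size xs"
  unfolding increasing_size_def
proof (rule upward_predicate_iff_card_le)
  assume *: "\<forall>a\<in>set xs. t \<le> a \<longrightarrow> increasing_from a xs"
  show "increasing_from t xs"
    unfolding increasing_from_def
  proof (intro allI impI)
    fix p q assume s: "subseq [p, q] xs" "t \<le> p" "t \<le> q"
    then have "min p q \<in> set xs" using subseq_set[OF s(1)] by (auto simp: min_def)
    then have "increasing_from (min p q) xs" using * s by simp
    then show "p < q"
      unfolding increasing_from_def using s(1) min.cobounded1 min.cobounded2 by blast
  qed
qed (simp, erule increasing_from_mono)

lemma increasing_size_le_layered_size: "increasing_size xs \<le> layered_size xs"
  unfolding increasing_size_def layered_size_def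
  by (rule card_mono) (simp_all add: subset_iff increasing_imp_layered)

text \<open>The largest letter alone is increasing.\<close>
lemma increasing_size_pos:
  assumes "distinct xs" "xs \<noteq> []"
  shows "1 \<le> increasing_size xs"
proof -
  have "increasing_from (Max (set xs)) xs"
    unfolding increasing_from_def
  proof (intro allI impI)
    fix p q assume s: "subseq [p, q] xs" "Max (set xs) \<le> p" "Max (set xs) \<le> q"
    have "p \<in> set xs" "q \<in> set xs" using subseq_set[OF s(1)] by auto
    then have "p \<le> Max (set xs)" "q \<le> Max (set xs)" by simp_all
    then have "p = q" using s(2,3) by linarith
    then show "p < q" using subseq_pair_neq[OF assms(1) s(1)] by simp
  qed
  then have "Max (set xs) \<in> {a \<in> set xs. increasing_from a xs}" using assms(2) by simp
  then have "card {a \<in> set xs. increasing_from a xs} > 0"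
    using card_gt_0_iff by fastforce
  then show ?thesis unfolding increasing_size_def by simp
qed

section \<open>The succession rule\<close>

text \<open>
  The label after inserting a first letter with \<open>m \<le> l\<close> letters above it, where \<open>l\<close> is the old
  label and the \<open>i\<close> largest letters form the maximal increasing top part.
\<close>
definition child_label :: "nat \<Rightarrow> nat \<Rightarrow> nat \<Rightarrow> nat" where
  "child_label i l m = (if m = 0 \<or> m = i then l + 1 else if m < i then m + 1 else m)"

text \<open>
  Let \<open>H\<close> be the set of the \<open>m\<close> letters above \<open>k\<close>; all of them still count for the new label. The
  letter \<open>k\<close> itself counts iff \<open>H\<close> is increasing, since a descent in \<open>H\<close> gives a 132 with \<open>k\<close>;
  this is \<open>m \<le> i\<close>, and smaller letters can count only in that case. Then a smaller letter that
  counted before is lost iff it, or a letter between it and \<open>k\<close>, stands to the left of a letter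
  of \<open>H\<close>: inserting \<open>k\<close> in front completes such a pair to a 213. If \<open>H\<close> is empty, nothing is lost. If \<open>0 < m < i\<close>, the letter just below \<open>k\<close> precedes
  all of \<open>H\<close>, so every smaller letter is lost. If \<open>m = i\<close>, nothing is lost: the letter \<open>p\<close> just
  below \<open>k\<close> stands to the right of some \<open>s\<close> in \<open>H\<close>, and a loss would produce a 132 or 213 that
  was present before.
\<close>
lemma layered_size_Cons:
  assumes dist: "distinct xs" and k: "k \<notin> set xs" and lay: "layered_from k xs"
  shows "layered_size (k # xs) =
    child_label (increasing_size xs) (layered_size xs) (card {a \<in> set xs. k \<le> a})"
proof -
  define H where "H = {a \<in> set xs. k \<le> a}"
  \<comment> \<open>the letters below \<open>k\<close> that count for the new label\<close>
  define L where "L = {a \<in> set xs. a < k \<and> layered_from a (k # xs)}"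
  have H_gt: "a > k" if "a \<in> H" for a using that k unfolding H_def by (cases "a = k") auto
  have fin: "finite H" "finite L" unfolding H_def L_def by simp_all
  have kk: "layered_from k (k # xs) \<longleftrightarrow> increasing_from k xs"
  proof
    assume *: "layered_from k (k # xs)"
    show "increasing_from k xs"
      unfolding increasing_from_def
    proof (intro allI impI)
      fix p q assume s: "subseq [p, q] xs" "k \<le> p" "k \<le> q"
      then have "k \<noteq> q" using subseq_set[OF s(1)] k by auto
      then show "p < q"
        using * s subseq_pair_neq[OF dist s(1)] unfolding layered_from_Cons
        by (meson le_neq_implies_less linorder_neqE_nat order.refl)
    qed
  next
    assume "increasing_from k xs"
    then show "layered_from k (k # xs)"
      using lay unfolding layered_from_Cons increasing_from_def by fastforce
  qed
  have below: "layered_from a (k # xs) \<Longrightarrow> increasing_from k xs" if "a < k" for a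
    using kk layered_from_mono that less_imp_le by blast
  have "a \<in> set (k # xs) \<and> layered_from a (k # xs) \<longleftrightarrow>
      a \<in> H \<or> increasing_from k xs \<and> (a = k \<or> a \<in> L)" for a
  proof -
    have "layered_from a (k # xs)" if "a \<in> H"
      using layered_from_mono[OF lay, of a] H_gt[OF that] unfolding layered_from_Cons by simp
    moreover have "a < k \<or> a = k \<or> a \<in> H" if "a \<in> set xs"
      using that unfolding H_def by auto
    ultimately show ?thesis
      using kk below[of a] unfolding H_def L_def by auto
  qed
  then have Collect: "{a \<in> set (k # xs). layered_from a (k # xs)} =
      H \<union> (if increasing_from k xs then insert k L else {})" by auto
  have "H \<inter> insert k L = {}" "k \<notin> L" using H_gt unfolding H_def L_def by auto
  then have size: "layered_size (k # xs) =
      card H + (if increasing_from k xs then Suc (card L) else 0)"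
    unfolding layered_size_def Collect using fin by (simp add: card_Un_disjoint)
  have inc_iff: "increasing_from k xs \<longleftrightarrow> card H \<le> increasing_size xs"
    unfolding H_def by (rule increasing_from_iff_card_le)
  have split: "layered_size xs = card H + card {a \<in> set xs. a < k \<and> layered_from a xs}"
  proof -
    have "{a \<in> set xs. layered_from a xs} = H \<union> {a \<in> set xs. a < k \<and> layered_from a xs}"
      using layered_from_mono[OF lay] unfolding H_def by auto
    moreover have "H \<inter> {a \<in> set xs. a < k \<and> layered_from a xs} = {}" unfolding H_def by auto
    ultimately show ?thesis unfolding layered_size_def using fin by (simp add: card_Un_disjoint)
  qed
  have pred: "\<exists>p\<in>set xs. p < k \<and> (\<forall>a\<in>set xs. a < k \<longrightarrow> a \<le> p)"
    if "b \<in> set xs" "b < k" for b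
  proof -
    let ?B = "{a \<in> set xs. a < k}"
    have "Max ?B \<in> ?B" using that by (intro Max_in) auto
    then show ?thesis by (intro bexI[of _ "Max ?B"]) auto
  qed
  consider (zero) "card H = 0" | (big) "card H > increasing_size xs"
    | (less) "0 < card H" "card H < increasing_size xs"
    | (eq) "0 < card H" "card H = increasing_size xs" by linarith
  then have "layered_size (k # xs) = child_label (increasing_size xs) (layered_size xs) (card H)"
  proof cases
    case zero
    then have H: "H = {}" using fin by simp
    have "L = {a \<in> set xs. a < k \<and> layered_from a xs}"
    proof -
      have "r \<notin> set xs" if "k < r" for r using H that unfolding H_def by auto
      then have "\<not> k < r" if "subseq [q, r] xs" for q r using subseq_set[OF that] by auto
      then show ?thesis unfolding L_def layered_from_Cons by blast
    qed
    then show ?thesis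
      using size split inc_iff zero by (simp add: child_label_def)
  next
    case big
    then show ?thesis using size inc_iff by (simp add: child_label_def)
  next
    case less
    have "L = {}"
    proof -
      obtain b where b: "b \<in> set xs" "b < k" "increasing_from b xs"
      proof -
        have "\<not> {a \<in> set xs. increasing_from a xs} \<subseteq> H"
          using less(2) card_mono[OF fin(1)] unfolding increasing_size_def by (meson not_less)
        then obtain b where "b \<in> set xs" "increasing_from b xs" "b \<notin> H" by blast
        then show thesis using that[of b] unfolding H_def by simp
      qed
      obtain r where r: "r \<in> H" using less(1) by fastforce
      obtain p where p: "p \<in> set xs" "p < k" "\<And>a. a \<in> set xs \<Longrightarrow> a < k \<Longrightarrow> a \<le> p"
        using pred b by blast
      have "increasing_from p xs" using increasing_from_mono[OF b(3) p(3)[OF b(1,2)]] .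
      moreover have "p < r" "r \<in> set xs" using r p H_gt unfolding H_def by fastforce+
      ultimately have "subseq [p, r] xs"
        using subseq_pair_total[of p xs r] p(1) unfolding increasing_from_def
        by (metis less_imp_le_nat less_not_refl order.refl order_less_asym)
      then have "\<not> layered_from a (k # xs)" if "a \<in> set xs" "a < k" for a
        using p(2) p(3)[OF that] H_gt[OF r] that unfolding layered_from_Cons
        by (meson le_trans less_imp_le_nat)
      then show ?thesis unfolding L_def by blast
    qed
    then show ?thesis using size inc_iff less by (simp add: child_label_def)
  next
    case eq
    have inc: "increasing_from k xs" using eq inc_iff by simp
    have "layered_from a (k # xs)" if a: "a \<in> set xs" "a < k" "layered_from a xs" for a
    proof -
      have no: False if qr: "subseq [q, r] xs" "a \<le> q" "q < k" "k < r" for q r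
      proof -
        obtain p where p: "p \<in> set xs" "p < k" "\<And>a. a \<in> set xs \<Longrightarrow> a < k \<Longrightarrow> a \<le> p"
          using pred[OF a(1,2)] by blast
        have mem: "q \<in> set xs" "r \<in> set xs" using subseq_set[OF qr(1)] by auto
        have qp: "q \<le> p" using p(3)[OF mem(1) qr(3)] .
        \<comment> \<open>otherwise \<open>H\<close> together with \<open>p\<close> would be an increasing top part of size \<open>i + 1\<close>\<close>
        have "\<not> increasing_from p xs"
        proof
          assume "increasing_from p xs"
          moreover from this have "increasing_from b xs" if "b \<in> H" for b
            using increasing_from_mono[of p xs b] p(2) H_gt[OF that] by simp
          ultimately have "insert p H \<subseteq> {a \<in> set xs. increasing_from a xs}"
            using p(1) unfolding H_def by blast
          then have "card (insert p H) \<le> increasing_size xs"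
            unfolding increasing_size_def by (intro card_mono) auto
          moreover have "p \<notin> H" using p(2) H_gt[of p] by linarith
          ultimately show False using eq fin by simp
        qed
        then obtain s t where st: "subseq [s, t] xs" "p \<le> s" "p \<le> t" "\<not> s < t"
          unfolding increasing_from_def by blast
        have st': "s \<in> set xs" "t \<in> set xs" "t < s"
          using subseq_set[OF st(1)] subseq_pair_neq[OF dist st(1)] st(4) by auto
        have ks: "k \<le> s" using st(3) st'(1,3) p(3)[of s] by linarith
        have "\<not> k \<le> t" using increasing_fromD[OF inc st(1) ks] st(4) by blast
        then have "t = p" using p(3)[of t] st(3) st'(2) by simp
        then have sp: "subseq [s, p] xs" using st by simp
        have "s \<noteq> q" using ks qr by simp
        then consider "subseq [s, q] xs" | "subseq [q, s] xs"
          using subseq_pair_total[OF st'(1) mem(1)] by blast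
        then show False
        proof cases
          \<comment> \<open>\<open>s q r\<close> is a 213 in the first case, and \<open>q s p\<close> is a 132 in the second\<close>
          case 1
          then have sqr: "subseq [s, q, r] xs" and "subseq [s, r] xs"
            using subseq_pair_join[OF dist _ qr(1)] subseq_pair_trans[OF dist _ qr(1)] by simp_all
          then have "s < r" using increasing_fromD[OF inc] ks qr(4) by simp
          then show False
            using layered_from_no_213[OF a(3) sqr] qr ks by simp
        next
          case 2
          then have qsp: "subseq [q, s, p] xs" and "subseq [q, p] xs"
            using subseq_pair_join[OF dist _ sp] subseq_pair_trans[OF dist _ sp] by simp_all
          then have "q < p" using subseq_pair_neq[OF dist, of q p] qp by simp
          then show False
            using layered_from_no_132[OF a(3) qsp] qr p(2) ks by simp
        qed
      qed
      have "\<not> (k < r \<and> r < q)" if "subseq [q, r] xs" for q r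
        using increasing_fromD[OF inc that] by linarith
      then show ?thesis using a(3) no unfolding layered_from_Cons by metis
    qed
    then have "L = {a \<in> set xs. a < k \<and> layered_from a xs}"
      using layered_from_Cons[of _ k xs] unfolding L_def by blast
    then show ?thesis using size split inc eq by (simp add: child_label_def)
  qed
  then show ?thesis unfolding H_def .
qed

text \<open>
  The label \<open>l + 1\<close> comes from \<open>m = 0\<close> and \<open>m = i\<close>; the values \<open>0 < m < i\<close> give \<open>2, \<dots>, i\<close> and
  the values \<open>i < m \<le> l\<close> give \<open>i + 1, \<dots>, l\<close>. The dependence on \<open>i\<close> disappears, so that no second
  label has to be carried along.
\<close>
lemma card_child_label:
  assumes "1 \<le> i" "i \<le> l"
  shows "card {m \<in> {..l}. child_label i l m = j} =
    2 * of_bool (l + 1 = j) + of_bool (2 \<le> j \<and> j \<le> l)"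
proof -
  have "{m \<in> {..l}. child_label i l m = j} =
    (if j = l + 1 then {0, i} else if 2 \<le> j \<and> j \<le> i then {j - 1}
     else if i < j \<and> j \<le> l then {j} else {})"
    using assms by (auto simp: child_label_def split: if_splits)
  then show ?thesis using assms by auto
qed

section \<open>Inserting a first letter\<close>

text \<open>The order-preserving relabelling that makes room for the letter \<open>k\<close>.\<close>

definition skip :: "nat \<Rightarrow> nat \<Rightarrow> nat" where
  "skip k i = (if i < k then i else Suc i)"

lemma strict_mono_skip: "strict_mono (skip k)"
  by (rule strict_monoI) (auto simp: skip_def)

lemma inj_on_skip: "inj_on (skip k) A"
  using inj_on_subset[OF strict_mono_imp_inj_on[OF strict_mono_skip] subset_UNIV] .

lemma image_skip:
  assumes "1 \<le> k" "k \<le> Suc n"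
  shows "skip k ` {1..n} = {1..Suc n} - {k}"
proof
  show "skip k ` {1..n} \<subseteq> {1..Suc n} - {k}" by (auto simp: skip_def)
  show "{1..Suc n} - {k} \<subseteq> skip k ` {1..n}"
  proof
    fix a assume a: "a \<in> {1..Suc n} - {k}"
    show "a \<in> skip k ` {1..n}"
    proof (cases "a < k")
      case True
      then have "a = skip k a" "a \<in> {1..n}" using a assms by (auto simp: skip_def)
      then show ?thesis by blast
    next
      case False
      then have "a = skip k (a - 1)" "a - 1 \<in> {1..n}" using a assms by (auto simp: skip_def)
      then show ?thesis by blast
    qed
  qed
qed

lemma layered_from_map:
  assumes f: "strict_mono f"
  shows "layered_from (f t) (map f xs) \<longleftrightarrow> layered_from t xs"
proof -
  have "(\<exists>p q r. subseq [p, q, r] (map f xs) \<and> P p q r) \<longleftrightarrow>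
      (\<exists>p q r. subseq [p, q, r] xs \<and> P (f p) (f q) (f r))" for P
  proof -
    have preimage: "\<exists>p' q' r'. p = f p' \<and> q = f q' \<and> r = f r' \<and> subseq [p', q', r'] xs"
      if "subseq [p, q, r] (map f xs)" for p q r
      using that subseq_map_iff[OF strict_mono_imp_inj_on[OF f], of "[p, q, r]" xs]
      by (auto simp: Cons_eq_map_conv)
    then show ?thesis using subseq_map[of "[p, q, r]" xs f for p q r] by (simp, blast)
  qed
  from this[of "\<lambda>p q r. f t \<le> p \<and> p < r \<and> r < q \<or> f t \<le> q \<and> q < p \<and> p < r"]
  show ?thesis
    unfolding layered_from_def strict_mono_less[OF f] strict_mono_less_eq[OF f] by blast
qed

lemma increasing_from_map:
  assumes f: "strict_mono f"
  shows "increasing_from (f t) (map f xs) \<longleftrightarrow> increasing_from t xs"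
proof -
  have "(\<exists>p q. subseq [p, q] (map f xs) \<and> P p q) \<longleftrightarrow>
      (\<exists>p q. subseq [p, q] xs \<and> P (f p) (f q))" for P
  proof -
    have preimage: "\<exists>p' q'. p = f p' \<and> q = f q' \<and> subseq [p', q'] xs"
      if "subseq [p, q] (map f xs)" for p q
      using that subseq_map_iff[OF strict_mono_imp_inj_on[OF f], of "[p, q]" xs]
      by (auto simp: Cons_eq_map_conv)
    then show ?thesis using subseq_map[of "[p, q]" xs f for p q] by (simp, blast)
  qed
  from this[of "\<lambda>p q. f t \<le> p \<and> f t \<le> q \<and> \<not> p < q"]
  show ?thesis
    unfolding increasing_from_def strict_mono_less[OF f] strict_mono_less_eq[OF f] by blast
qed

lemma avoids_both_map:
  assumes f: "strict_mono f"
  shows "avoids_both (map f xs) \<longleftrightarrow> avoids_both xs"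
proof -
  have "(\<exists>a b c d. subseq [a, b, c, d] (map f xs) \<and> P a b c d) \<longleftrightarrow>
      (\<exists>a b c d. subseq [a, b, c, d] xs \<and> P (f a) (f b) (f c) (f d))" for P
  proof -
    have preimage: "\<exists>a' b' c' d'. a = f a' \<and> b = f b' \<and> c = f c' \<and> d = f d' \<and>
        subseq [a', b', c', d'] xs"
      if "subseq [a, b, c, d] (map f xs)" for a b c d
      using that subseq_map_iff[OF strict_mono_imp_inj_on[OF f], of "[a, b, c, d]" xs]
      by (auto simp: Cons_eq_map_conv)
    show ?thesis
    proof
      assume "\<exists>a b c d. subseq [a, b, c, d] (map f xs) \<and> P a b c d"
      then obtain a b c d where *: "subseq [a, b, c, d] (map f xs)" "P a b c d" by blast
      then show "\<exists>a b c d. subseq [a, b, c, d] xs \<and> P (f a) (f b) (f c) (f d)"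
        using preimage[OF *(1)] by blast
    next
      assume "\<exists>a b c d. subseq [a, b, c, d] xs \<and> P (f a) (f b) (f c) (f d)"
      then obtain a b c d where *: "subseq [a, b, c, d] xs" "P (f a) (f b) (f c) (f d)" by blast
      then show "\<exists>a b c d. subseq [a, b, c, d] (map f xs) \<and> P a b c d"
        using subseq_map[OF *(1), of f] by auto
    qed
  qed
  from this[of "\<lambda>a b c d. a < b \<and> b < d \<and> d < c \<or> a < c \<and> c < b \<and> b < d"]
  show ?thesis
    unfolding avoids_both_def strict_mono_less[OF f] by blast
qed

lemma layered_size_map:
  assumes f: "strict_mono f"
  shows "layered_size (map f xs) = layered_size xs"
proof -
  have "{a \<in> set (map f xs). layered_from a (map f xs)} = f ` {a \<in> set xs. layered_from a xs}"
    using layered_from_map[OF f] by auto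
  then show ?thesis
    unfolding layered_size_def
    by (simp add: card_image inj_on_subset[OF strict_mono_imp_inj_on[OF f] subset_UNIV])
qed

lemma increasing_size_map:
  assumes f: "strict_mono f"
  shows "increasing_size (map f xs) = increasing_size xs"
proof -
  have "{a \<in> set (map f xs). increasing_from a (map f xs)} =
      f ` {a \<in> set xs. increasing_from a xs}"
    using increasing_from_map[OF f] by auto
  then show ?thesis
    unfolding increasing_size_def
    by (simp add: card_image inj_on_subset[OF strict_mono_imp_inj_on[OF f] subset_UNIV])
qed

lemma avoiding_perms_eq_schroeder_perms:
  "avoiding_perms n [1,2,4,3] [1,3,2,4] = schroeder_perms n"
  unfolding avoiding_perms_def schroeder_perms_def avoids_both_iff ..

lemma schroeder_perms_iff:
  "\<pi> \<in> schroeder_perms n \<longleftrightarrow> set \<pi> = {1..n} \<and> distinct \<pi> \<and> avoids_both \<pi>"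
  unfolding schroeder_perms_def permutations_of_set_def by blast

lemma finite_schroeder_perms: "finite (schroeder_perms n)"
  unfolding schroeder_perms_def by simp

lemma layered_size_le:
  assumes "\<sigma> \<in> schroeder_perms n"
  shows "layered_size \<sigma> \<le> n"
proof -
  have "layered_size \<sigma> \<le> card (set \<sigma>)"
    unfolding layered_size_def by (rule card_mono) auto
  also have "\<dots> = n" using assms by (simp add: schroeder_perms_iff)
  finally show ?thesis .
qed

lemma increasing_size_schroeder_pos:
  assumes "\<sigma> \<in> schroeder_perms (Suc n)"
  shows "1 \<le> increasing_size \<sigma>"
proof -
  have "distinct \<sigma>" "\<sigma> \<noteq> []" using assms by (auto simp: schroeder_perms_iff)
  then show ?thesis by (rule increasing_size_pos)
qed

text \<open>
  The new permutation has length \<open>n + 1\<close>. The parameter \<open>m\<close> is the number of letters that exceed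
  its first letter; unlike the first letter it ranges over an initial segment.
\<close>
definition prepend :: "nat \<Rightarrow> nat list \<Rightarrow> nat \<Rightarrow> nat list" where
  "prepend n \<sigma> m = (Suc n - m) # map (skip (Suc n - m)) \<sigma>"

text \<open>
  Relabelling by \<open>skip\<close> changes neither avoidance nor the two sizes, so both claims are those
  about \<open>k # xs\<close> with the letters above \<open>k = n + 1 - m\<close> counted as \<open>m\<close>.
\<close>
lemma
  assumes "\<sigma> \<in> schroeder_perms n" "m \<le> n"
  shows prepend_mem_iff: "prepend n \<sigma> m \<in> schroeder_perms (Suc n) \<longleftrightarrow> m \<le> layered_size \<sigma>"
    and layered_size_prepend: "m \<le> layered_size \<sigma> \<Longrightarrow>
      layered_size (prepend n \<sigma> m) = child_label (increasing_size \<sigma>) (layered_size \<sigma>) m"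
proof -
  define k where "k = Suc n - m"
  define \<tau> where "\<tau> = map (skip k) \<sigma>"
  have k: "1 \<le> k" "k \<le> Suc n" using assms(2) unfolding k_def by auto
  have \<sigma>: "set \<sigma> = {1..n}" "distinct \<sigma>" "avoids_both \<sigma>"
    using assms(1) unfolding schroeder_perms_iff by auto
  have set: "set \<tau> = {1..Suc n} - {k}"
    unfolding \<tau>_def using image_skip[OF k] \<sigma>(1) by simp
  have dist: "distinct \<tau>"
    unfolding \<tau>_def using \<sigma>(2) by (simp add: distinct_map inj_on_skip)
  have "{a \<in> set \<tau>. k \<le> a} = {Suc k..Suc n}" unfolding set using k by auto
  then have card: "card {a \<in> set \<tau>. k \<le> a} = m" using assms(2) unfolding k_def by simp
  have size: "layered_size \<tau> = layered_size \<sigma>" "increasing_size \<tau> = increasing_size \<sigma>"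
    unfolding \<tau>_def by (simp_all add: layered_size_map increasing_size_map strict_mono_skip)
  have lay: "layered_from k \<tau> \<longleftrightarrow> m \<le> layered_size \<sigma>"
    using layered_from_iff_card_le[of k \<tau>] unfolding card size .
  have pre: "prepend n \<sigma> m = k # \<tau>" unfolding prepend_def k_def \<tau>_def ..
  have mem: "k \<notin> set \<tau>" unfolding set by simp
  have av: "avoids_both (k # \<tau>) \<longleftrightarrow> m \<le> layered_size \<sigma>"
    using avoids_both_Cons[OF mem] avoids_both_map[OF strict_mono_skip, of k \<sigma>] \<sigma>(3) lay
    unfolding \<tau>_def by blast
  have "k \<in> {1..Suc n}" using k by simp
  then have "set (k # \<tau>) = {1..Suc n}" unfolding list.set set by blast
  then show "prepend n \<sigma> m \<in> schroeder_perms (Suc n) \<longleftrightarrow> m \<le> layered_size \<sigma>"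
    unfolding schroeder_perms_iff pre using av dist mem by (simp only: distinct.simps) blast
  show "layered_size (prepend n \<sigma> m) = child_label (increasing_size \<sigma>) (layered_size \<sigma>) m"
    if "m \<le> layered_size \<sigma>"
    using layered_size_Cons[OF dist mem lay[THEN iffD2, OF that]] unfolding pre size card .
qed

lemma bij_betw_prepend:
  "bij_betw (\<lambda>(\<sigma>, m). prepend n \<sigma> m)
     (SIGMA \<sigma>:schroeder_perms n. {..layered_size \<sigma>}) (schroeder_perms (Suc n))"
  unfolding bij_betw_def
proof
  show "inj_on (\<lambda>(\<sigma>, m). prepend n \<sigma> m) (SIGMA \<sigma>:schroeder_perms n. {..layered_size \<sigma>})"
  proof (rule inj_onI, clarify)
    fix \<sigma> m \<sigma>' m'
    assume *: "\<sigma> \<in> schroeder_perms n" "m \<le> layered_size \<sigma>"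
      "\<sigma>' \<in> schroeder_perms n" "m' \<le> layered_size \<sigma>'" "prepend n \<sigma> m = prepend n \<sigma>' m'"
    then have "m \<le> n" "m' \<le> n" using layered_size_le le_trans by blast+
    moreover have "Suc n - m = Suc n - m'" using *(5) unfolding prepend_def by simp
    ultimately have m: "m = m'" by linarith
    then have "map (skip (Suc n - m)) \<sigma> = map (skip (Suc n - m)) \<sigma>'"
      using *(5) unfolding prepend_def by simp
    then have "\<sigma> = \<sigma>'" using map_injective[OF _ inj_on_skip] by blast
    then show "\<sigma> = \<sigma>' \<and> m = m'" using m by simp
  qed
  show "(\<lambda>(\<sigma>, m). prepend n \<sigma> m) ` (SIGMA \<sigma>:schroeder_perms n. {..layered_size \<sigma>}) =
      schroeder_perms (Suc n)" (is "?f ` ?S = _")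
  proof
    show "?f ` ?S \<subseteq> schroeder_perms (Suc n)"
      using prepend_mem_iff order.trans[OF _ layered_size_le] by auto
    show "schroeder_perms (Suc n) \<subseteq> ?f ` ?S"
    proof
      fix \<pi> assume \<pi>: "\<pi> \<in> schroeder_perms (Suc n)"
      then have \<pi>': "set \<pi> = {1..Suc n}" "distinct \<pi>" "avoids_both \<pi>"
        unfolding schroeder_perms_iff by auto
      then obtain k \<tau> where k\<tau>: "\<pi> = k # \<tau>" by (cases \<pi>) auto
      have k: "1 \<le> k" "k \<le> Suc n" using \<pi>'(1) k\<tau> by auto
      have mem: "k \<notin> set \<tau>" using \<pi>'(2) k\<tau> by simp
      then have "set \<tau> = skip k ` {1..n}"
        unfolding image_skip[OF k] \<pi>'(1)[symmetric] k\<tau> by auto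
      then obtain \<sigma> where \<sigma>: "\<tau> = map (skip k) \<sigma>" "set \<sigma> = {1..n}"
      proof -
        let ?g = "inv_into {1..n} (skip k)"
        have "map (skip k) (map ?g \<tau>) = \<tau>"
          using \<open>set \<tau> = _\<close> by (auto simp: f_inv_into_f intro: map_idI)
        moreover have "set (map ?g \<tau>) = {1..n}"
          using \<open>set \<tau> = _\<close> inv_into_image_cancel[OF inj_on_skip, of "{1..n}"] by simp
        ultimately show thesis using that[of "map ?g \<tau>"] by simp
      qed
      have "avoids_both \<sigma>"
        using \<pi>'(3) avoids_both_Cons[OF mem] avoids_both_map[OF strict_mono_skip, of k \<sigma>]
        unfolding k\<tau> \<sigma>(1) by simp
      moreover have "distinct \<sigma>" using \<pi>'(2) k\<tau> \<sigma>(1) by (simp add: distinct_map)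
      ultimately have mem\<sigma>: "\<sigma> \<in> schroeder_perms n" unfolding schroeder_perms_iff using \<sigma>(2) by simp
      have "Suc n - (Suc n - k) = k" using k by simp
      then have pre: "prepend n \<sigma> (Suc n - k) = \<pi>" unfolding prepend_def k\<tau> \<sigma>(1) by simp
      then have "Suc n - k \<le> layered_size \<sigma>"
        using prepend_mem_iff[OF mem\<sigma>, of "Suc n - k"] \<pi> k by simp
      then show "\<pi> \<in> ?f ` ?S" using mem\<sigma> pre by force
    qed
  qed
qed

lemma sum_schroeder_perms_Suc:
  "(\<Sum>\<pi>\<in>schroeder_perms (Suc n). f \<pi>) =
     (\<Sum>\<sigma>\<in>schroeder_perms n. \<Sum>m\<le>layered_size \<sigma>. f (prepend n \<sigma> m))"
  by (subst sum.Sigma)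
     (auto simp: finite_schroeder_perms case_prod_unfold
       sum.reindex_bij_betw[OF bij_betw_prepend, symmetric])

section \<open>Counting permutations by their label\<close>
definition label_count :: "nat \<Rightarrow> nat \<Rightarrow> nat" where
  "label_count n j = card {\<pi> \<in> schroeder_perms n. layered_size \<pi> = j}"

definition tail_count :: "nat \<Rightarrow> nat \<Rightarrow> nat" where
  "tail_count n j = card {\<pi> \<in> schroeder_perms n. j \<le> layered_size \<pi>}"

lemma card_filter_schroeder_perms:
  "card {\<pi> \<in> schroeder_perms n. P \<pi>} = (\<Sum>\<pi>\<in>schroeder_perms n. of_bool (P \<pi>))"
  using finite_schroeder_perms by (simp add: of_bool_def Int_def flip: sum.inter_filter)

text \<open>
  Nonempty permutations have label at least 1, so \<open>m = 0\<close> and \<open>m = 1\<close> are always both legal.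
\<close>
lemma label_count_zero: "label_count (Suc n) 0 = 0"
proof -
  have "layered_size \<pi> \<noteq> 0" if "\<pi> \<in> schroeder_perms (Suc n)" for \<pi>
    using increasing_size_schroeder_pos[OF that] increasing_size_le_layered_size[of \<pi>] by simp
  then show ?thesis unfolding label_count_def by (auto simp: card_eq_0_iff)
qed

lemma tail_count_zero: "tail_count (Suc n) 0 = tail_count (Suc n) 1"
proof -
  have "1 \<le> layered_size \<pi>" if "\<pi> \<in> schroeder_perms (Suc n)" for \<pi>
    using increasing_size_schroeder_pos[OF that] increasing_size_le_layered_size[of \<pi>] by simp
  then show ?thesis unfolding tail_count_def by (intro arg_cong[of _ _ card]) auto
qed

text \<open>
  The succession rule read backwards. The factor \<open>of_bool (1 \<le> j)\<close> is there because the labels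
  that arise once each start at 2.
\<close>
lemma label_count_Suc:
  "label_count (Suc (Suc n)) (Suc j) =
     2 * label_count (Suc n) j + of_bool (1 \<le> j) * tail_count (Suc n) (Suc j)"
proof -
  have "label_count (Suc (Suc n)) (Suc j) =
      (\<Sum>\<sigma>\<in>schroeder_perms (Suc n). \<Sum>m\<le>layered_size \<sigma>.
        of_bool (layered_size (prepend (Suc n) \<sigma> m) = Suc j))"
    unfolding label_count_def card_filter_schroeder_perms sum_schroeder_perms_Suc ..
  also have "\<dots> = (\<Sum>\<sigma>\<in>schroeder_perms (Suc n).
      2 * of_bool (layered_size \<sigma> = j) + of_bool (1 \<le> j) * of_bool (Suc j \<le> layered_size \<sigma>))"
  proof (rule sum.cong[OF refl])
    fix \<sigma> assume \<sigma>: "\<sigma> \<in> schroeder_perms (Suc n)"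
    let ?i = "increasing_size \<sigma>" and ?l = "layered_size \<sigma>"
    have "(\<Sum>m\<le>?l. of_bool (layered_size (prepend (Suc n) \<sigma> m) = Suc j)) =
        (\<Sum>m\<le>?l. of_bool (child_label ?i ?l m = Suc j) :: nat)"
      using layered_size_prepend[OF \<sigma>] layered_size_le[OF \<sigma>] by (intro sum.cong) auto
    also have "\<dots> = card {m \<in> {..?l}. child_label ?i ?l m = Suc j}"
      by (simp add: of_bool_def Int_def flip: sum.inter_filter)
    also have "\<dots> = 2 * of_bool (?l + 1 = Suc j) + of_bool (2 \<le> Suc j \<and> Suc j \<le> ?l)"
      using card_child_label increasing_size_schroeder_pos[OF \<sigma>] increasing_size_le_layered_size
      by blast
    also have "\<dots> = 2 * of_bool (?l = j) + of_bool (1 \<le> j) * of_bool (Suc j \<le> ?l)"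
      by (cases "1 \<le> j") simp_all
    finally show "(\<Sum>m\<le>?l. of_bool (layered_size (prepend (Suc n) \<sigma> m) = Suc j)) =
        (2 :: nat) * of_bool (?l = j) + of_bool (1 \<le> j) * of_bool (Suc j \<le> ?l)" .
  qed
  also have "\<dots> = 2 * label_count (Suc n) j + of_bool (1 \<le> j) * tail_count (Suc n) (Suc j)"
    unfolding label_count_def tail_count_def card_filter_schroeder_perms
    by (simp only: sum.distrib sum_distrib_left)
  finally show ?thesis .
qed

lemma schroeder_perms_one: "schroeder_perms (Suc 0) = {[1]}"
proof -
  have "permutations_of_set {1..Suc 0} = {[1]}" by simp
  moreover have "avoids_both [1]" unfolding avoids_both_def by (simp add: subseq_Cons_simps)
  ultimately show ?thesis unfolding schroeder_perms_def by blast
qed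

lemma label_count_one: "label_count (Suc 0) (Suc j) = of_bool (j = 0)"
proof -
  have "layered_from 1 [1]" unfolding layered_from_def by simp
  then have "{a. a = 1 \<and> layered_from a [1]} = {1}" by auto
  then have "layered_size [1] = 1" unfolding layered_size_def by simp
  then have "{\<pi> \<in> {[1]}. layered_size \<pi> = Suc j} = (if j = 0 then {[1]} else {})" by auto
  then show ?thesis unfolding label_count_def schroeder_perms_one by simp
qed

text \<open>
  Labels are at most the length, so the upper limit \<open>n\<close> loses nothing. It does not depend on \<open>j\<close>,
  which matches the geometric series below.
\<close>
lemma tail_count_eq_sum:
  "tail_count (Suc n) (Suc j) = (\<Sum>i\<le>n. label_count (Suc n) (Suc (j + i)))"
proof -
  have "(\<Sum>i\<le>n. of_bool (layered_size \<pi> = Suc (j + i)) :: nat) = of_bool (Suc j \<le> layered_size \<pi>)"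
    if "\<pi> \<in> schroeder_perms (Suc n)" for \<pi>
  proof -
    have "{i \<in> {..n}. layered_size \<pi> = Suc (j + i)} =
        (if Suc j \<le> layered_size \<pi> then {layered_size \<pi> - Suc j} else {})"
      using layered_size_le[OF that] by auto
    then have "card {i \<in> {..n}. layered_size \<pi> = Suc (j + i)} = of_bool (Suc j \<le> layered_size \<pi>)"
      by simp
    then show ?thesis by (simp add: of_bool_def Int_def flip: sum.inter_filter)
  qed
  then show ?thesis
    unfolding label_count_def tail_count_def card_filter_schroeder_perms
    by (subst sum.swap) simp
qed

section \<open>The label distribution as powers of a series\<close>

lemma fps_mult_power_nth_zero:
  fixes F S :: "'a :: field fps"
  assumes "fps_nth S 0 = 0"
  shows "fps_nth (F * S ^ Suc n) n = 0"
proof -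
  have "fps_nth (S ^ Suc n) i = 0" if "i \<le> n" for i
    using startsby_zero_power_prefix[OF assms, of "Suc n"] that by simp
  then show ?thesis unfolding fps_mult_nth by simp
qed

text \<open>
  Since the powers of \<open>S\<close> vanish to increasing order, each coefficient of the geometric series is
  a finite sum.
\<close>
lemma fps_geometric_nth:
  fixes F S :: "'a :: field fps"
  assumes "fps_nth S 0 = 0"
  shows "fps_nth (F * inverse (1 - S)) n = (\<Sum>i\<le>n. fps_nth (F * S ^ i) n)"
proof -
  have unit: "inverse (1 - S) * (1 - S) = 1"
    using assms by (intro inverse_mult_eq_1) simp
  have abstract: "g = s + g * p" if "1 - p = (1 - S) * s" "g * (1 - S) = 1" for g s p
    using that by algebra
  have "1 - S ^ Suc n = (1 - S) * (\<Sum>i\<le>n. S ^ i)"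
    using one_diff_power_eq[of S "Suc n"] by (simp only: lessThan_Suc_atMost)
  then have "inverse (1 - S) = (\<Sum>i\<le>n. S ^ i) + inverse (1 - S) * S ^ Suc n"
    using unit abstract by blast
  then have "F * inverse (1 - S) = F * ((\<Sum>i\<le>n. S ^ i) + inverse (1 - S) * S ^ Suc n)"
    by (rule arg_cong)
  also have "\<dots> = (\<Sum>i\<le>n. F * S ^ i) + (F * inverse (1 - S)) * S ^ Suc n"
    by (simp only: distrib_left sum_distrib_left mult.assoc)
  finally have "fps_nth (F * inverse (1 - S)) n =
      fps_nth ((\<Sum>i\<le>n. F * S ^ i) + (F * inverse (1 - S)) * S ^ Suc n) n"
    by (rule arg_cong)
  also have "\<dots> = (\<Sum>i\<le>n. fps_nth (F * S ^ i) n)"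
    using fps_mult_power_nth_zero[OF assms, of "F * inverse (1 - S)" n]
    by (simp only: fps_add_nth fps_sum_nth add_0_right)
  finally show ?thesis .
qed

text \<open>
  The constant \<open>c\<close> rescales the length variable: the equation for \<open>R\<close> is that of the kernel root
  at \<open>c x\<close>. In the application \<open>c\<close> is the variable \<open>v\<close>.
\<close>
context
  fixes c :: "'a :: field_char_0" and R :: "'a fps"
  assumes R0: "fps_nth R 0 = 0"
    and R_quadratic: "R ^ 2 = (1 + fps_const c * fps_X) * R - 2 * (fps_const c * fps_X)"
begin

text \<open>
  This is the recurrence \<open>label_count_Suc\<close> for generating functions: \<open>2 R\<^sup>i\<close> accounts for the
  label that arises twice and the geometric tail \<open>R\<^sup>i\<^sup>+\<^sup>1 / (1 - R)\<close> for the labels that arise once.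
\<close>
lemma R_power_Suc:
  "R ^ Suc i = fps_const c * (fps_X * (2 * R ^ i + R ^ Suc i * inverse (1 - R)))"
proof -
  define G where "G = inverse (1 - R)"
  have G: "G * (1 - R) = 1" unfolding G_def using R0 by (intro inverse_mult_eq_1) simp
  have R: "R = fps_const c * fps_X * (2 + R * G)"
    using R_quadratic G by algebra
  have "R ^ Suc i = R ^ i * R" by (rule power_Suc2)
  also have "\<dots> = R ^ i * (fps_const c * fps_X * (2 + R * G))"
    by (rule arg_cong[OF R])
  also have "\<dots> = fps_const c * (fps_X * (2 * R ^ i + R ^ Suc i * G))"
    by (simp only: power_Suc2 distrib_left mult_ac)
  finally show ?thesis unfolding G_def .
qed

lemma label_count_eq_power:
  "c ^ n * of_nat (label_count (Suc n) (Suc j)) = fps_nth (R ^ j) n"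
  and tail_count_eq_power:
  "c ^ n * of_nat (tail_count (Suc n) (Suc j)) = fps_nth (R ^ j * inverse (1 - R)) n"
proof -
  have tail: "c ^ n * of_nat (tail_count (Suc n) (Suc j)) = fps_nth (R ^ j * inverse (1 - R)) n"
    if "\<And>i. c ^ n * of_nat (label_count (Suc n) (Suc i)) = fps_nth (R ^ i) n" for n j
    unfolding tail_count_eq_sum fps_geometric_nth[OF R0] of_nat_sum sum_distrib_left
    by (simp only: that power_add)
  have label: "c ^ n * of_nat (label_count (Suc n) (Suc j)) = fps_nth (R ^ j) n" for n j
  proof (induction n arbitrary: j)
    case 0
    then show ?case using R0 by (simp add: label_count_one fps_nth_power_0 power_0_left)
  next
    case (Suc n)
    show ?case
    proof (cases j)
      case 0
      then show ?thesis by (simp add: label_count_Suc label_count_zero)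
    next
      case (Suc i)
      have "c ^ Suc n * of_nat (label_count (Suc (Suc n)) (Suc (Suc i))) =
          c * (2 * (c ^ n * of_nat (label_count (Suc n) (Suc i))) +
            c ^ n * of_nat (tail_count (Suc n) (Suc (Suc i))))"
        unfolding label_count_Suc by (simp add: algebra_simps)
      also have "\<dots> = c * (2 * fps_nth (R ^ i) n + fps_nth (R ^ Suc i * inverse (1 - R)) n)"
        unfolding Suc.IH tail[OF Suc.IH] ..
      also have "\<dots> = fps_nth (R ^ Suc i) (Suc n)"
        by (subst R_power_Suc) (simp add: numeral_fps_const)
      finally show ?thesis unfolding Suc .
    qed
  qed
  show "c ^ n * of_nat (label_count (Suc n) (Suc j)) = fps_nth (R ^ j) n" by (rule label)
  show "c ^ n * of_nat (tail_count (Suc n) (Suc j)) = fps_nth (R ^ j * inverse (1 - R)) n"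
    by (rule tail[OF label])
qed

section \<open>The first letter\<close>

text \<open>
  A permutation of length \<open>n + 2\<close> arises from one of length \<open>n + 1\<close> with label at least \<open>m\<close> and
  has first letter \<open>n + 2 - m\<close>. The first summand on the right is the contribution of \<open>m = 0\<close>. The
  other one comes from \<open>m = i + 1\<close>, where the weight \<open>c\<^sup>n\<^sup>+\<^sup>1\<^sup>-\<^sup>i\<close> is \<open>c\<^sup>n\<close>, absorbed by the
  rescaled length, times \<open>c c\<^sup>-\<^sup>i\<close>, so that the tails \<open>R\<^sup>i / (1 - R)\<close> add up to a geometric series
  in \<open>R / c\<close>.
\<close>
lemma sum_hd_schroeder_perms:
  assumes "c \<noteq> 0"
  shows "(\<Sum>\<pi>\<in>schroeder_perms (Suc (Suc n)). c ^ hd \<pi>) =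
    fps_nth (fps_const (c ^ 2) * inverse (1 - R) +
      fps_const c * (inverse (1 - R) * inverse (1 - fps_const (inverse c) * R))) n"
proof -
  let ?G = "inverse (1 - R)" and ?S = "fps_const (inverse c) * R"
  have "(\<Sum>\<pi>\<in>schroeder_perms (Suc (Suc n)). c ^ hd \<pi>) =
      (\<Sum>\<sigma>\<in>schroeder_perms (Suc n). \<Sum>m\<le>layered_size \<sigma>. c ^ (Suc (Suc n) - m))"
    unfolding sum_schroeder_perms_Suc prepend_def by simp
  also have "\<dots> = (\<Sum>\<sigma>\<in>schroeder_perms (Suc n). \<Sum>m\<le>Suc n.
      c ^ (Suc (Suc n) - m) * of_bool (m \<le> layered_size \<sigma>))"
  proof (rule sum.cong[OF refl])
    fix \<sigma> assume "\<sigma> \<in> schroeder_perms (Suc n)"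
    then have "layered_size \<sigma> \<le> Suc n" by (rule layered_size_le)
    then show "(\<Sum>m\<le>layered_size \<sigma>. c ^ (Suc (Suc n) - m)) =
        (\<Sum>m\<le>Suc n. c ^ (Suc (Suc n) - m) * of_bool (m \<le> layered_size \<sigma>))"
      by (intro sum.mono_neutral_cong_left) auto
  qed
  also have "\<dots> = (\<Sum>m\<le>Suc n. c ^ (Suc (Suc n) - m) * of_nat (tail_count (Suc n) m))"
    unfolding tail_count_def card_filter_schroeder_perms
    by (subst sum.swap) (simp add: sum_distrib_left)
  also have "\<dots> = c ^ Suc (Suc n) * of_nat (tail_count (Suc n) 1) +
      (\<Sum>i\<le>n. c ^ (Suc n - i) * of_nat (tail_count (Suc n) (Suc i)))"
    unfolding sum.atMost_Suc_shift by (simp add: tail_count_zero)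
  also have "c ^ Suc (Suc n) * of_nat (tail_count (Suc n) 1) = c ^ 2 * fps_nth ?G n"
    using tail_count_eq_power[of n 0] by (simp add: power2_eq_square mult.assoc)
  also have "(\<Sum>i\<le>n. c ^ (Suc n - i) * of_nat (tail_count (Suc n) (Suc i))) =
      (\<Sum>i\<le>n. c * fps_nth (?G * ?S ^ i) n)"
  proof (rule sum.cong[OF refl])
    fix i assume "i \<in> {..n}"
    then have "c ^ (Suc n - i) = c * inverse c ^ i * c ^ n"
      using assms by (simp add: Suc_diff_le power_diff field_simps)
    then have "c ^ (Suc n - i) * of_nat (tail_count (Suc n) (Suc i)) =
        c * inverse c ^ i * fps_nth (R ^ i * ?G) n"
      using tail_count_eq_power[of n i] by (simp only: mult.assoc)
    also have "\<dots> = c * fps_nth (?G * ?S ^ i) n"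
    proof -
      have "?G * ?S ^ i = fps_const (inverse c ^ i) * (R ^ i * ?G)"
        by (simp only: power_mult_distrib fps_const_power mult_ac)
      then show ?thesis by (simp only: fps_mult_left_const_nth mult.assoc)
    qed
    finally show "c ^ (Suc n - i) * of_nat (tail_count (Suc n) (Suc i)) =
        c * fps_nth (?G * ?S ^ i) n" .
  qed
  also have "\<dots> = c * fps_nth (?G * inverse (1 - ?S)) n"
    using fps_geometric_nth[of ?S ?G n] R0 by (simp add: sum_distrib_left)
  finally show ?thesis by simp
qed

end

lemma ratfun_var_nonzero: "ratfun_var \<noteq> 0"
  by (simp add: ratfun_var_def Zero_fract_def eq_fract)

theorem corollary20:
  fixes v x :: "ratfun fps"
  defines "v \<equiv> fps_const ratfun_var" and "x \<equiv> fps_X"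
  shows "first_letter_gf [1,2,4,3] [1,3,2,4] =
    (v * x * (2 - 3 * v - 3 * x + 3 * v * x)
      + v * x * (v + x - v * x) * (v * x + fps_sqrt1 (1 - 6 * v * x + v ^ 2 * x ^ 2)))
    / (2 * (1 - v - 2 * x + v * x))"
proof -
  define Q where "Q = fps_sqrt1 (1 - 6 * v * x + v ^ 2 * x ^ 2)"
  have "fps_nth (1 - 6 * v * x + v ^ 2 * x ^ 2) 0 = 1"
    unfolding v_def x_def by (simp add: numeral_fps_const power2_eq_square)
  then have Q: "Q ^ 2 = 1 - 6 * v * x + v ^ 2 * x ^ 2" "fps_nth Q 0 = 1"
    unfolding Q_def using fps_sqrt1_unique by blast+
  \<comment> \<open>the root of the quadratic that has no constant term\<close>
  define R where "R = fps_const (1 / 2) * (1 + v * x - Q)"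
  have half: "2 * fps_const (1 / 2 :: ratfun) = 1"
    by (simp add: numeral_fps_const)
  have QR: "Q = 1 + v * x - 2 * R"
    unfolding R_def mult.assoc[symmetric] half by simp
  have R0: "fps_nth R 0 = 0" unfolding R_def v_def x_def using Q(2) by simp
  have "4 * R ^ 2 = 4 * ((1 + v * x) * R - 2 * (v * x))"
    using Q(1) unfolding QR by (simp add: power2_eq_square algebra_simps)
  moreover have "(4 :: ratfun fps) \<noteq> 0" by (simp add: numeral_fps_const)
  ultimately have R2: "R ^ 2 = (1 + v * x) * R - 2 * (v * x)"
    by (simp only: mult_cancel_left) simp
  define G where "G = inverse (1 - R)"
  define H where "H = inverse (1 - fps_const (inverse ratfun_var) * R)"
  define A where "A = first_letter_gf [1,2,4,3] [1,3,2,4]"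
  have G: "G * (1 - R) = 1" unfolding G_def using R0 by (intro inverse_mult_eq_1) simp
  have "v * fps_const (inverse ratfun_var) = 1"
    unfolding v_def using ratfun_var_nonzero by simp
  moreover have "H * (1 - fps_const (inverse ratfun_var) * R) = 1"
    unfolding H_def using R0 by (intro inverse_mult_eq_1) simp
  ultimately have H: "H * (v - R) = v" by algebra
  have A: "A = v * x + x ^ 2 * (v ^ 2 * G + v * (G * H))"
  proof (rule fps_ext)
    fix n
    have rest: "fps_nth A (Suc (Suc m)) = fps_nth (v ^ 2 * G + v * (G * H)) m" for m
      using sum_hd_schroeder_perms[OF R0 R2[unfolded v_def x_def] ratfun_var_nonzero, of m]
      unfolding A_def first_letter_gf_def avoiding_perms_eq_schroeder_perms G_def H_def v_def
      by (simp add: fps_const_power)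
    consider "n = 0" | "n = 1" | m where "n = Suc (Suc m)"
      by (metis One_nat_def not0_implies_Suc)
    then show "fps_nth A n = fps_nth (v * x + x ^ 2 * (v ^ 2 * G + v * (G * H))) n"
    proof cases
      case 1
      then show ?thesis
        unfolding A_def first_letter_gf_def x_def by (simp add: power2_eq_square)
    next
      case 2
      then show ?thesis
        unfolding A_def first_letter_gf_def avoiding_perms_eq_schroeder_perms x_def v_def
        by (simp add: power2_eq_square schroeder_perms_one mult.assoc)
    next
      case (3 m)
      then show ?thesis
        using rest[of m] unfolding x_def by (simp add: power2_eq_square mult.assoc v_def)
    qed
  qed
  define N where "N = v * x * (2 - 3 * v - 3 * x + 3 * v * x)
    + v * x * (v + x - v * x) * (v * x + Q)"
  define D where "D = 2 * (1 - v - 2 * x + v * x)"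
  \<comment> \<open>After clearing the denominators of \<open>G\<close> and \<open>H\<close>, the claim is a polynomial identity modulo
    the quadratic equation of \<open>R\<close>.\<close>
  have "A * ((1 - R) * (v - R)) = v * x * (1 - R) * (v - R) + x ^ 2 * v ^ 2 * (v - R + 1)"
    unfolding A using G H by algebra
  then have "(A * D) * ((1 - R) * (v - R)) = N * ((1 - R) * (v - R))"
    unfolding N_def D_def QR using R2 by algebra
  moreover have "(1 - R) * (v - R) \<noteq> 0"
  proof -
    have "fps_nth ((1 - R) * (v - R)) 0 \<noteq> 0"
      using R0 ratfun_var_nonzero unfolding v_def by simp
    then show ?thesis by auto
  qed
  ultimately have "N = A * D" by simp
  moreover have "D \<noteq> 0"
    using denominator_unit unfolding D_def v_def x_def by (metis fps_zero_nth)
  ultimately have "A = N / D" by simp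
  then show ?thesis unfolding A_def N_def D_def Q_def .
qed

end
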